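(* Let $R$ be a commutative ring with unit element and let $R'$ be the subring of $R$ generated by $1$. If $n:=s(R)<\infty$, then $$s(R';R)\le \operatorname{lcm}(\Lambda)+\Lambda,\qquad\text{where } \Lambda=(n!)^{(2n)^{n}\,n}.$$
   Context: For a subring $S$ (containing $1$) of a commutative ring $R$ with unit element, define $$s(S;R):=\min\{m\in\mathbb{N} : \exists\, p\in S[x] \text{ with } \deg(p)<m \text{ and } p(x)=x^m \text{ for all } x\in R\},$$ with $s(S;R):=\infty$ if no such $m$ exists, and $s(R):=s(R;R)$. Here $\mathbb{N}=\{1,2,3,\dots\}$ and the zero polynomial is regarded as having degree smaller than every natural number. For a positive integer $N$, $\operatorname{lcm}(N)$ denotes the least common multiple of the numbers in the set $\{1,2,\ldots,N\}$. The exponent in $\Lambda$ is the product $(2n)^n\cdot n$. The ring $R$ may be infinite. *)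

theory Defs
  imports
    "HOL-Algebra.Polynomials"
    "HOL-Algebra.Generated_Rings"
    "HOL-Library.Extended_Nat"
begin

text \<open>
  Polynomials over a subring \<open>S\<close> are the lists in \<open>carrier (S [X]\<^bsub>R\<^esub>)\<close>; they are evaluated in \<open>R\<close>.
  The library gives the zero polynomial \<open>[]\<close> degree 0. Since \<open>s_witness\<close> requires \<open>m > 0\<close>, the
  condition \<open>degree p < m\<close> always holds for it, in accordance with the convention that the zero
  polynomial has degree smaller than every natural number.
\<close>

definition s_witness :: "'a set \<Rightarrow> ('a, 'b) ring_scheme \<Rightarrow> nat \<Rightarrow> bool"
  where "s_witness S R m \<longleftrightarrow> m > 0 \<and>
    (\<exists>p \<in> carrier (S [X]\<^bsub>R\<^esub>). degree p < m \<and>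
      (\<forall>x \<in> carrier R. ring.eval R p x = x [^]\<^bsub>R\<^esub> m))"

definition s_rel :: "'a set \<Rightarrow> ('a, 'b) ring_scheme \<Rightarrow> enat"
  where "s_rel S R =
    (if \<exists>m. s_witness S R m then enat (LEAST m. s_witness S R m) else \<infinity>)"

definition s_ring :: "('a, 'b) ring_scheme \<Rightarrow> enat"
  where "s_ring R = s_rel (carrier R) R"

definition lcm_upto :: "nat \<Rightarrow> nat"
  where "lcm_upto N = Lcm {1..N}"

end

theory Submission
  imports Defs
begin

text \<open>
  The polynomial over the prime subring that witnesses the bound is \<open>x\<^sup>\<Lambda>\<close>: every element of \<open>R\<close> satisfies
  \<open>x^(lcm(\<Lambda>) + \<Lambda>) = x^\<Lambda>\<close>. This holds as soon as, for each \<open>x\<close>, all powers of \<open>x\<close> lie in a set of at most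
  \<open>\<Lambda>\<close> elements. Then two of \<open>x^0, \<dots>, x^\<Lambda>\<close> agree, so the powers of \<open>x\<close> are periodic from some
  exponent at most \<open>\<Lambda>\<close> on, with a period that is at most \<open>\<Lambda>\<close> and hence divides \<open>lcm(\<Lambda>)\<close>
  (\<open>power_lcm_upto_eq\<close>).

  To find such a set, let \<open>x^n = a_0 + a_1 x + \<dots> + a_{n-1} x^{n-1}\<close> hold on \<open>R\<close>.
  The \<open>n\<close>-th finite difference of the right-hand side along the multiples of \<open>1\<close> vanishes, whereas that of
  the left-hand side is \<open>n!\<close>, so \<open>n! = 0\<close> in \<open>R\<close> (\<open>fact_annihilates\<close>). It therefore suffices that the powers
  of \<open>x\<close> are integer combinations of \<open>(2n)^n n\<close> elements, since these have at most
  \<open>(n!)^((2n)^n n) = \<Lambda>\<close> integer combinations altogether (\<open>card_int_combinations\<close>).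

  The generators are the products of a monomial in the \<open>a_i\<close> with all exponents below \<open>2n\<close> and a power
  \<open>x^j\<close> with \<open>j < n\<close> (\<open>monomials_in_int_combinations\<close>). Larger \<open>j\<close> are reduced by the relation for \<open>x\<close>.
  For the exponents of the \<open>a_i\<close>, the relation is applied to the element \<open>a_i^2\<close>, giving
  \<open>a_i^(2n) = \<Sum>k<n. a_k a_i^(2k)\<close>; every term on the right has degree at most \<open>2n - 1\<close> in the \<open>a\<close>'s,
  so the rewriting terminates. The relation for \<open>a_i\<close> itself would not do, because its term
  \<open>a_{n-1} a_i^{n-1}\<close> again has degree \<open>n\<close>.
\<close>

section \<open>Finite differences of powers\<close>

text \<open>
  Absorption, \<open>i * (n choose i) = n * (n-1 choose i-1)\<close>, followed by the binomial expansion of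
  \<open>(i + 1)^l\<close>, turns the sum for \<open>n\<close> and \<open>l + 1\<close> into a combination of the sums for \<open>n - 1\<close> and exponents
  \<open>j \<le> l\<close>; among these only \<open>j = n - 1\<close> is nonzero.
\<close>

lemma sum_alternating_choose_power:
  "k \<le> n \<Longrightarrow> (\<Sum>i\<le>n. (- 1) ^ i * int (n choose i) * int i ^ k)
      = (if k = n then (- 1) ^ n * fact n else 0)"
proof (induction n arbitrary: k)
  case 0
  then show ?case by simp
next
  case (Suc n)
  show ?case
  proof (cases k)
    case 0
    then show ?thesis
      using choose_alternating_sum[of "Suc n", where ?'a = int] by simp
  next
    case (Suc l)
    then have l: "l \<le> n" using Suc.prems by simp
    have absorb: "int (Suc n choose Suc i) * int (Suc i) = int (Suc n) * int (n choose i)" for i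
      using Suc_times_binomial_eq[of n i] by (metis mult.commute of_nat_mult)
    have "(\<Sum>i\<le>Suc n. (- 1) ^ i * int (Suc n choose i) * int i ^ k)
        = (\<Sum>i\<le>n. (- 1) ^ Suc i * int (Suc n choose Suc i) * int (Suc i) ^ Suc l)"
      unfolding Suc by (subst sum.atMost_Suc_shift) simp
    also have "\<dots> = (\<Sum>i\<le>n. (- 1) ^ Suc i * (int (Suc n choose Suc i) * int (Suc i)) * int (Suc i) ^ l)"
      by (simp add: algebra_simps)
    also have "\<dots> = (\<Sum>i\<le>n. \<Sum>j\<le>l. - int (Suc n) * (int (l choose j) *
        ((- 1) ^ i * int (n choose i) * int i ^ j)))"
    proof (rule sum.cong[OF refl])
      fix i
      have "int (Suc i) ^ l = (\<Sum>j\<le>l. int (l choose j) * int i ^ j)"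
        using binomial_ring[of "int i" 1 l] by (simp add: add.commute)
      then show "(- 1) ^ Suc i * (int (Suc n choose Suc i) * int (Suc i)) * int (Suc i) ^ l
        = (\<Sum>j\<le>l. - int (Suc n) * (int (l choose j) * ((- 1) ^ i * int (n choose i) * int i ^ j)))"
        unfolding absorb by (simp only: sum_distrib_left) (rule sum.cong, simp_all add: algebra_simps)
    qed
    also have "\<dots> = (\<Sum>j\<le>l. - int (Suc n) * (int (l choose j) *
        (\<Sum>i\<le>n. (- 1) ^ i * int (n choose i) * int i ^ j)))"
      by (subst sum.swap) (simp only: sum_distrib_left)
    also have "\<dots> = (\<Sum>j\<le>l. - int (Suc n) * (int (l choose j) *
        (if j = n then (- 1) ^ n * fact n else 0)))"
      by (rule sum.cong[OF refl]) (use Suc.IH l in auto)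
    also have "\<dots> = (\<Sum>j\<le>l. if n = j then - int (Suc n) * (int (l choose n) * ((- 1) ^ n * fact n)) else 0)"
      by (rule sum.cong) auto
    also have "\<dots> = (if k = Suc n then (- 1) ^ Suc n * fact (Suc n) else 0)"
      using l Suc by (simp add: sum.delta' algebra_simps)
    finally show ?thesis .
  qed
qed

context cring
begin

lemma int_multiple_one_power:
  "([(m::int)] \<cdot> \<one>) [^] (k::nat) = [(m ^ k)] \<cdot> \<one>"
proof (induction k)
  case 0
  then show ?case by (simp add: add_pow_int_ge)
next
  case (Suc k)
  then show ?case
    by (simp add: add_pow_ldistr_int add_pow_rdistr_int add.int_pow_pow mult.commute)
qed

lemma finsum_int_multiples:
  assumes "finite I" "v \<in> carrier R"
  shows "(\<Oplus>i\<in>I. [(c i :: int)] \<cdot> v) = [(\<Sum>i\<in>I. c i)] \<cdot> v"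
  using assms
proof (induction I rule: finite_induct)
  case empty
  then show ?case by (simp add: add_pow_int_ge)
next
  case (insert i I)
  then show ?case by (simp add: add.int_pow_mult)
qed

lemma weighted_integer_monomials:
  fixes w :: "nat \<Rightarrow> int"
  assumes "c \<in> carrier R" "finite I"
  shows "(\<Oplus>i\<in>I. [w i] \<cdot> (c \<otimes> ([int i] \<cdot> \<one>) [^] (k::nat)))
    = [(\<Sum>i\<in>I. w i * int i ^ k)] \<cdot> c"
proof -
  have "[w i] \<cdot> (c \<otimes> ([int i] \<cdot> \<one>) [^] k) = [(w i * int i ^ k)] \<cdot> c" for i
    using assms by (simp add: int_multiple_one_power add_pow_rdistr_int add.int_pow_pow mult.commute)
  then show ?thesis
    using assms by (simp add: finsum_int_multiples)
qed

text \<open>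
  The \<open>n\<close>-th finite difference, up to sign, kills polynomials of degree below \<open>n\<close>. The coefficients of
  \<open>p\<close> are arbitrary elements of \<open>R\<close>, but at integer arguments each monomial is an integer multiple of its
  coefficient, so the identity for integer powers applies term by term.
\<close>

lemma finite_difference_eval:
  assumes "set p \<subseteq> carrier R" "length p \<le> n"
  shows "(\<Oplus>i\<in>{..n}. [((- 1) ^ i * int (n choose i))] \<cdot> eval p ([int i] \<cdot> \<one>)) = \<zero>"
  using assms
proof (induction p)
  case Nil
  then show ?case by simp
next
  case (Cons c p)
  let ?w = "\<lambda>i. (- 1) ^ i * int (n choose i)"
  let ?x = "\<lambda>i. [int i] \<cdot> \<one>"
  have c: "c \<in> carrier R" and p: "set p \<subseteq> carrier R" and len: "length p \<le> n"
    using Cons.prems by auto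
  have "(\<Oplus>i\<in>{..n}. [?w i] \<cdot> eval (c # p) (?x i))
    = (\<Oplus>i\<in>{..n}. [?w i] \<cdot> (c \<otimes> ?x i [^] length p) \<oplus> [?w i] \<cdot> eval p (?x i))"
    using c p by (intro finsum_cong') (auto simp: add.int_pow_distrib eval_in_carrier)
  also have "\<dots> = (\<Oplus>i\<in>{..n}. [?w i] \<cdot> (c \<otimes> ?x i [^] length p))
      \<oplus> (\<Oplus>i\<in>{..n}. [?w i] \<cdot> eval p (?x i))"
    using c p by (intro finsum_addf) (auto simp: eval_in_carrier)
  also have "\<dots> = [(\<Sum>i\<le>n. ?w i * int i ^ length p)] \<cdot> c \<oplus> \<zero>"
    by (simp only: weighted_integer_monomials[OF c finite_atMost] Cons.IH[OF p len])
  also have "\<dots> = \<zero>"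
    using Cons.prems c by (simp add: sum_alternating_choose_power add_pow_int_ge)
  finally show ?case .
qed

text \<open>
  The \<open>n\<close>-th finite difference of \<open>x^n = p(x)\<close> is zero on the right and \<open>n!\<close>, up to sign, on the left.
\<close>

lemma fact_annihilates:
  assumes p: "set p \<subseteq> carrier R" "length p \<le> n"
    and rel: "\<And>x. x \<in> carrier R \<Longrightarrow> eval p x = x [^] n"
    and v: "v \<in> carrier R"
  shows "[(fact n :: int)] \<cdot> v = \<zero>"
proof -
  have "\<zero> = (\<Oplus>i\<in>{..n}. [((- 1) ^ i * int (n choose i))] \<cdot> (\<one> \<otimes> ([int i] \<cdot> \<one>) [^] n))"
    using finite_difference_eval[OF p] by (simp add: rel)
  also have "\<dots> = [((- 1) ^ n * fact n :: int)] \<cdot> \<one>"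
    by (subst weighted_integer_monomials) (simp_all add: sum_alternating_choose_power)
  finally have z: "[((- 1) ^ n * fact n :: int)] \<cdot> \<one> = \<zero>" by simp
  have "[(fact n :: int)] \<cdot> v = [(((- 1) ^ n * fact n) * (- 1) ^ n :: int)] \<cdot> (\<one> \<otimes> v)"
    using v by (simp add: mult.commute mult.left_commute flip: power_mult_distrib)
  also have "\<dots> = ([((- 1) ^ n :: int)] \<cdot> ([((- 1) ^ n * fact n :: int)] \<cdot> \<one>)) \<otimes> v"
    using v by (simp only: add_pow_ldistr_int add.int_pow_pow one_closed add.int_pow_closed)
  also have "\<dots> = \<zero>" using v by (simp add: z)
  finally show ?thesis .
qed

section \<open>Integer combinations of finitely many elements\<close>

definition int_combinations :: "'i set \<Rightarrow> ('i \<Rightarrow> 'a) \<Rightarrow> 'a set" where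
  "int_combinations I v = (\<lambda>c :: 'i \<Rightarrow> int. \<Oplus>i\<in>I. [c i] \<cdot> v i) ` UNIV"

lemma generator_in_int_combinations:
  assumes "finite I" "v \<in> I \<rightarrow> carrier R" "j \<in> I"
  shows "v j \<in> int_combinations I v"
proof -
  have vj: "v j \<in> carrier R" using assms by blast
  have "(\<Oplus>i\<in>I. [(if j = i then 1 else 0 :: int)] \<cdot> v i) = (\<Oplus>i\<in>I. if j = i then v i else \<zero>)"
    using assms vj by (intro finsum_cong') (auto simp: add_pow_int_ge)
  also have "\<dots> = v j" using assms by (intro finsum_singleton) auto
  finally have "v j = (\<Oplus>i\<in>I. [(if j = i then 1 else 0 :: int)] \<cdot> v i)" by (rule sym)
  then show ?thesis
    unfolding int_combinations_def by (intro image_eqI[where x = "\<lambda>i. if j = i then 1 else 0"]) simp_all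
qed

lemma finsum_in_int_combinations:
  assumes "finite I" "v \<in> I \<rightarrow> carrier R" "finite J"
    and "\<And>j. j \<in> J \<Longrightarrow> f j \<in> int_combinations I v"
  shows "(\<Oplus>j\<in>J. f j) \<in> int_combinations I v"
proof -
  have "\<forall>j\<in>J. \<exists>c. f j = (\<Oplus>i\<in>I. [(c i :: int)] \<cdot> v i)"
    using assms(4) unfolding int_combinations_def by blast
  then obtain c :: "_ \<Rightarrow> _ \<Rightarrow> int"
    where c: "\<And>j. j \<in> J \<Longrightarrow> f j = (\<Oplus>i\<in>I. [c j i] \<cdot> v i)"
    by metis
  have "(\<Oplus>j\<in>J. f j) = (\<Oplus>i\<in>I. [(\<Sum>j\<in>J. c j i)] \<cdot> v i)"
    using assms(3) c
  proof (induction J rule: finite_induct)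
    case empty
    have "(\<Oplus>i\<in>I. [(0 :: int)] \<cdot> v i) = (\<Oplus>i\<in>I. \<zero>)"
      using assms(2) by (intro finsum_cong') (auto simp: add_pow_int_ge)
    then show ?case by simp
  next
    case (insert j J)
    have "f k \<in> carrier R" if "k \<in> insert j J" for k
      unfolding insert.prems[OF that] by (rule finsum_closed) (use assms(2) in auto)
    then have f: "f \<in> J \<rightarrow> carrier R" "f j \<in> carrier R" by auto
    have "(\<Oplus>k\<in>insert j J. f k) = (\<Oplus>i\<in>I. [c j i] \<cdot> v i) \<oplus> (\<Oplus>i\<in>I. [(\<Sum>k\<in>J. c k i)] \<cdot> v i)"
      using insert f by simp
    also have "\<dots> = (\<Oplus>i\<in>I. [c j i] \<cdot> v i \<oplus> [(\<Sum>k\<in>J. c k i)] \<cdot> v i)"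
      using assms(2) by (intro finsum_addf[symmetric]) auto
    also have "\<dots> = (\<Oplus>i\<in>I. [(\<Sum>k\<in>insert j J. c k i)] \<cdot> v i)"
    proof (rule finsum_cong')
      fix i assume "i \<in> I"
      then have "v i \<in> carrier R" using assms(2) by blast
      then show "[c j i] \<cdot> v i \<oplus> [(\<Sum>k\<in>J. c k i)] \<cdot> v i
          = [(\<Sum>k\<in>insert j J. c k i)] \<cdot> v i"
        using insert.hyps by (simp add: add.int_pow_mult)
    qed (use assms(2) in auto)
    finally show ?case .
  qed
  then show ?thesis
    unfolding int_combinations_def by (intro image_eqI[where x = "\<lambda>i. \<Sum>j\<in>J. c j i"]) simp_all
qed

text \<open>
  Coefficients matter only modulo \<open>N\<close>.
\<close>

lemma card_int_combinations:
  assumes "finite I" "v \<in> I \<rightarrow> carrier R" "N > 0"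
    and tors: "\<And>i. i \<in> I \<Longrightarrow> [int N] \<cdot> v i = \<zero>"
  shows "finite (int_combinations I v)" "card (int_combinations I v) \<le> N ^ card I"
proof -
  let ?C = "I \<rightarrow>\<^sub>E {0..<int N}"
  let ?S = "\<lambda>c. \<Oplus>i\<in>I. [(c i :: int)] \<cdot> v i"
  have red: "[(k mod int N)] \<cdot> v i = [k] \<cdot> v i" if "i \<in> I" for k i
  proof -
    have vi: "v i \<in> carrier R" using that assms(2) by blast
    have "[k] \<cdot> v i = [(int N * (k div int N) + k mod int N)] \<cdot> v i" by simp
    also have "\<dots> = [(k div int N)] \<cdot> ([int N] \<cdot> v i) \<oplus> [(k mod int N)] \<cdot> v i"
      using vi by (simp only: add.int_pow_mult add.int_pow_pow)
    also have "\<dots> = [(k mod int N)] \<cdot> v i" using vi tors[OF that] by simp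
    finally show ?thesis by simp
  qed
  have "?S c \<in> ?S ` ?C" for c
  proof
    show "?S c = ?S (\<lambda>i\<in>I. c i mod int N)"
      using assms(2) by (intro finsum_cong') (auto simp: red)
    show "(\<lambda>i\<in>I. c i mod int N) \<in> ?C" using assms(3) by auto
  qed
  then have sub: "int_combinations I v \<subseteq> ?S ` ?C"
    unfolding int_combinations_def by blast
  have fin: "finite ?C" using assms(1) by (intro finite_PiE) auto
  show "finite (int_combinations I v)" using sub fin finite_surj by blast
  have "card (int_combinations I v) \<le> card ?C"
    using sub fin by (meson card_image_le card_mono finite_imageI order_trans)
  also have "card ?C = N ^ card I" using assms(1) by (simp add: card_PiE)
  finally show "card (int_combinations I v) \<le> N ^ card I" .
qed

section \<open>Monomials in the coefficients\<close>

lemma eval_as_finsum_coeff: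
  assumes "set p \<subseteq> carrier R" "length p \<le> m" "x \<in> carrier R"
  shows "eval p x = (\<Oplus>k\<in>{..<m}. coeff p k \<otimes> x [^] k)"
  using assms
proof (induction p)
  case Nil
  then show ?case by simp
next
  case (Cons c p)
  let ?t = "\<lambda>k. if length p = k then c \<otimes> x [^] k else \<zero>"
  have c: "c \<in> carrier R" and p: "set p \<subseteq> carrier R" using Cons.prems by auto
  have "(\<Oplus>k\<in>{..<m}. coeff (c # p) k \<otimes> x [^] k) = (\<Oplus>k\<in>{..<m}. ?t k \<oplus> coeff p k \<otimes> x [^] k)"
    using c p Cons.prems by (intro finsum_cong') (auto simp: coeff_length)
  also have "\<dots> = (\<Oplus>k\<in>{..<m}. ?t k) \<oplus> (\<Oplus>k\<in>{..<m}. coeff p k \<otimes> x [^] k)"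
    using c p Cons.prems by (intro finsum_addf) auto
  also have "(\<Oplus>k\<in>{..<m}. ?t k) = c \<otimes> x [^] length p"
    using c Cons.prems by (intro finsum_singleton) auto
  finally show ?case using Cons p by simp
qed

definition multi_monom :: "nat \<Rightarrow> (nat \<Rightarrow> 'a) \<Rightarrow> (nat \<Rightarrow> nat) \<Rightarrow> 'a" where
  "multi_monom n a \<alpha> = (\<Otimes>i\<in>{..<n}. a i [^] \<alpha> i)"

lemma multi_monom_closed [simp]:
  "a \<in> {..<n} \<rightarrow> carrier R \<Longrightarrow> multi_monom n a \<alpha> \<in> carrier R"
  unfolding multi_monom_def by (auto intro!: finprod_closed)

lemma multi_monom_raise:
  assumes "a \<in> {..<n} \<rightarrow> carrier R" "i < n"
  shows "multi_monom n a (\<alpha>(i := \<alpha> i + m)) = a i [^] m \<otimes> multi_monom n a \<alpha>"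
proof -
  have ak: "a k \<in> carrier R" if "k < n" for k using assms(1) that by blast
  note ai = ak[OF assms(2)]
  have "multi_monom n a (\<alpha>(i := \<alpha> i + m))
      = (\<Otimes>j\<in>{..<n}. (if i = j then a j [^] m else \<one>) \<otimes> a j [^] \<alpha> j)"
    unfolding multi_monom_def
  proof (rule finprod_cong')
    fix j assume "j \<in> {..<n}"
    then have "a j \<in> carrier R" using assms by blast
    then show "a j [^] (\<alpha>(i := \<alpha> i + m)) j = (if i = j then a j [^] m else \<one>) \<otimes> a j [^] \<alpha> j"
      by (simp add: nat_pow_mult ac_simps)
  qed (use assms ak in auto)
  also have "\<dots> = (\<Otimes>j\<in>{..<n}. if i = j then a j [^] m else \<one>) \<otimes> multi_monom n a \<alpha>"
    unfolding multi_monom_def using assms ai by (intro finprod_multf) auto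
  also have "(\<Otimes>j\<in>{..<n}. if i = j then a j [^] m else \<one>) = a i [^] m"
    using assms ai by (intro finprod_singleton) auto
  finally show ?thesis .
qed

text \<open>
  The box \<open>I\<close> of exponents is reached by two nested reductions. The inner one treats \<open>j < n\<close> by induction on
  the total degree in the \<open>a\<close>'s, using the relation for \<open>a_i^2\<close>. The outer one lowers \<open>j\<close> by the relation
  for \<open>x\<close>; this raises the degree in the \<open>a\<close>'s, which is harmless because the inner result covers all \<open>\<alpha>\<close>.
\<close>

lemma monomials_in_int_combinations:
  fixes n :: nat
  defines "I \<equiv> ({..<n} \<rightarrow>\<^sub>E {..<2 * n}) \<times> {..<n}"
  assumes a: "a \<in> {..<n} \<rightarrow> carrier R"
    and rel: "\<And>x. x \<in> carrier R \<Longrightarrow> x [^] n = (\<Oplus>k\<in>{..<n}. a k \<otimes> x [^] k)"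
    and x: "x \<in> carrier R"
  shows "multi_monom n a \<alpha> \<otimes> x [^] (j::nat)
    \<in> int_combinations I (\<lambda>(\<beta>, i). multi_monom n a \<beta> \<otimes> x [^] i)"
    (is "_ \<in> int_combinations I ?v")
proof -
  have fin: "finite I" unfolding I_def by (intro finite_cartesian_product finite_PiE) auto
  have v: "?v \<in> I \<rightarrow> carrier R" using a x by (auto simp: I_def)
  have ak: "a k \<in> carrier R" if "k < n" for k using a that by blast
  have low: "multi_monom n a \<alpha> \<otimes> x [^] j \<in> int_combinations I ?v" if j: "j < n" for \<alpha> j
  proof (induction "\<Sum>i<n. \<alpha> i" arbitrary: \<alpha> rule: less_induct)
    case less
    show ?case
    proof (cases "\<forall>i<n. \<alpha> i < 2 * n")
      case True
      then have "(restrict \<alpha> {..<n}, j) \<in> I" using j by (auto simp: I_def)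
      from generator_in_int_combinations[OF fin v this]
      have "multi_monom n a (restrict \<alpha> {..<n}) \<otimes> x [^] j \<in> int_combinations I ?v" by simp
      also have "multi_monom n a (restrict \<alpha> {..<n}) = multi_monom n a \<alpha>"
        unfolding multi_monom_def using a by (intro finprod_cong') auto
      finally show ?thesis .
    next
      case False
      then obtain i where i: "i < n" "2 * n \<le> \<alpha> i" by (meson not_less)
      \<comment> \<open>The factor \<open>a_i^(2n)\<close> is split off, leaving \<open>\<beta>\<close>. The \<open>k\<close>-th term of its expansion puts back
        \<open>a_i^(2k)\<close>, which gives \<open>\<gamma> k\<close>, and then the coefficient \<open>a_k\<close>, which gives \<open>\<delta> k\<close>. These are two
        successive updates because \<open>k\<close> may equal \<open>i\<close>.\<close>
      define \<beta> where "\<beta> = \<alpha>(i := \<alpha> i - 2 * n)"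
      define \<gamma> where "\<gamma> k = \<beta>(i := \<beta> i + 2 * k)" for k
      define \<delta> where "\<delta> k = (\<gamma> k)(k := \<gamma> k k + 1)" for k
      note ai = ak[OF i(1)]
      have "multi_monom n a \<alpha> = multi_monom n a (\<beta>(i := \<beta> i + 2 * n))"
        using i(2) by (simp add: \<beta>_def)
      also have "\<dots> = (a i [^] (2::nat)) [^] n \<otimes> multi_monom n a \<beta>"
        using multi_monom_raise[OF a i(1)] ai by (simp add: nat_pow_pow)
      also have "\<dots> = (\<Oplus>k\<in>{..<n}. a k \<otimes> (a i [^] (2::nat)) [^] k) \<otimes> multi_monom n a \<beta>"
        using ai by (simp add: rel)
      finally have "multi_monom n a \<alpha> \<otimes> x [^] j
          = (\<Oplus>k\<in>{..<n}. a k \<otimes> (a i [^] (2::nat)) [^] k) \<otimes> (multi_monom n a \<beta> \<otimes> x [^] j)"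
        using a x ai ak by (simp add: m_assoc finsum_closed)
      also have "\<dots> = (\<Oplus>k\<in>{..<n}. a k \<otimes> (a i [^] (2::nat)) [^] k \<otimes> (multi_monom n a \<beta> \<otimes> x [^] j))"
        using a x ai ak by (intro finsum_ldistr) auto
      also have "\<dots> = (\<Oplus>k\<in>{..<n}. multi_monom n a (\<delta> k) \<otimes> x [^] j)"
      proof (rule finsum_cong')
        fix k assume "k \<in> {..<n}"
        then have k: "k < n" by simp
        have "multi_monom n a (\<delta> k) = a k \<otimes> multi_monom n a (\<gamma> k)"
          unfolding \<delta>_def multi_monom_raise[OF a k] using ak[OF k] by simp
        also have "\<dots> = a k \<otimes> ((a i [^] (2::nat)) [^] k \<otimes> multi_monom n a \<beta>)"
          unfolding \<gamma>_def multi_monom_raise[OF a i(1)] using ai by (simp add: nat_pow_pow)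
        finally show "a k \<otimes> (a i [^] (2::nat)) [^] k \<otimes> (multi_monom n a \<beta> \<otimes> x [^] j)
            = multi_monom n a (\<delta> k) \<otimes> x [^] j"
          using a x ai ak[OF k] by (simp add: m_assoc)
      qed (use a x in auto)
      also have "\<dots> \<in> int_combinations I ?v"
      proof (rule finsum_in_int_combinations[OF fin v])
        fix k assume "k \<in> {..<n}"
        then have k: "k < n" by simp
        have upd: "(\<Sum>l<n. (f(m := f m + c)) l) = (\<Sum>l<n. f l) + c" if "m < n" for f m and c :: nat
        proof -
          have "(\<Sum>l<n. (f(m := f m + c)) l) = (\<Sum>l<n. f l + (if m = l then c else 0))"
            by (rule sum.cong) auto
          also have "\<dots> = (\<Sum>l<n. f l) + c" using that by (simp add: sum.distrib sum.delta')
          finally show ?thesis .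
        qed
        have "(\<Sum>l<n. \<alpha> l) = (\<Sum>l<n. (\<beta>(i := \<beta> i + 2 * n)) l)"
          using i(2) by (intro sum.cong) (auto simp: \<beta>_def)
        then have "(\<Sum>l<n. \<alpha> l) = (\<Sum>l<n. \<beta> l) + 2 * n"
          unfolding upd[OF i(1)] .
        moreover have "(\<Sum>l<n. \<delta> k l) = (\<Sum>l<n. \<beta> l) + 2 * k + 1"
          unfolding \<delta>_def upd[OF k] unfolding \<gamma>_def upd[OF i(1)] by simp
        ultimately have "(\<Sum>l<n. \<delta> k l) < (\<Sum>l<n. \<alpha> l)" using k by linarith
        then show "multi_monom n a (\<delta> k) \<otimes> x [^] j \<in> int_combinations I ?v" by (rule less)
      qed simp
      finally show ?thesis .
    qed
  qed
  show ?thesis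
  proof (induction j arbitrary: \<alpha> rule: less_induct)
    case (less j)
    show ?case
    proof (cases "j < n")
      case True
      then show ?thesis by (rule low)
    next
      case False
      then have "x [^] j = x [^] n \<otimes> x [^] (j - n)" using x by (simp add: nat_pow_mult)
      then have "multi_monom n a \<alpha> \<otimes> x [^] j
          = (\<Oplus>k\<in>{..<n}. a k \<otimes> x [^] k) \<otimes> (multi_monom n a \<alpha> \<otimes> x [^] (j - n))"
        using a x ak by (simp add: rel m_ac finsum_closed)
      also have "\<dots> = (\<Oplus>k\<in>{..<n}. a k \<otimes> x [^] k \<otimes> (multi_monom n a \<alpha> \<otimes> x [^] (j - n)))"
        using a x ak by (intro finsum_ldistr) auto
      also have "\<dots> = (\<Oplus>k\<in>{..<n}. multi_monom n a (\<alpha>(k := \<alpha> k + 1)) \<otimes> x [^] (k + (j - n)))"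
      proof (rule finsum_cong')
        fix k assume "k \<in> {..<n}"
        then have k: "k < n" by simp
        show "a k \<otimes> x [^] k \<otimes> (multi_monom n a \<alpha> \<otimes> x [^] (j - n))
            = multi_monom n a (\<alpha>(k := \<alpha> k + 1)) \<otimes> x [^] (k + (j - n))"
          unfolding multi_monom_raise[OF a k] nat_pow_mult[OF x, symmetric]
          using a x ak[OF k] by (simp add: m_ac)
      qed (use a x in auto)
      also have "\<dots> \<in> int_combinations I ?v"
        using False by (intro finsum_in_int_combinations[OF fin v] less) auto
      finally show ?thesis .
    qed
  qed
qed

section \<open>Repetition among powers\<close>

text \<open>
  If \<open>x^i = x^j\<close> with \<open>i < j \<le> N\<close>, then \<open>j - i\<close> is a period of the powers from \<open>x^i\<close> on. It is one of
  \<open>1, \<dots>, N\<close>, so it divides their least common multiple, whatever \<open>x\<close> is.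
\<close>

lemma power_lcm_upto_eq:
  assumes x: "x \<in> carrier R" and "finite M" "card M \<le> N"
    and pows: "\<And>i::nat. x [^] i \<in> M"
  shows "x [^] (lcm_upto N + N) = x [^] N"
proof -
  have "card ((\<lambda>i::nat. x [^] i) ` {0..N}) < card {0..N}"
  proof -
    have "card ((\<lambda>i::nat. x [^] i) ` {0..N}) \<le> card M"
      using assms(2) pows by (intro card_mono) auto
    then show ?thesis using assms(3) by simp
  qed
  then have "\<not> inj_on (\<lambda>i::nat. x [^] i) {0..N}" by (rule pigeonhole)
  then obtain i j :: nat where ij: "i < j" "j \<le> N" "x [^] i = x [^] j"
    unfolding inj_on_def by (metis atLeastAtMost_iff linorder_neqE_nat)
  define d where "d = j - i"
  have step: "x [^] (m + d) = x [^] m" if "i \<le> m" for m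
  proof -
    have "m + d = j + (m - i)" using that ij by (simp add: d_def)
    then have "x [^] (m + d) = x [^] (j + (m - i))" by simp
    also have "\<dots> = x [^] (i + (m - i))" using x ij(3) by (simp flip: nat_pow_mult)
    finally show ?thesis using that by simp
  qed
  have iter: "x [^] (N + d * t) = x [^] N" for t
  proof (induction t)
    case (Suc t)
    have "x [^] (N + d * Suc t) = x [^] ((N + d * t) + d)" by (simp add: ac_simps)
    also have "\<dots> = x [^] (N + d * t)" using ij by (intro step) simp
    finally show ?case using Suc by simp
  qed simp
  have "d dvd lcm_upto N" unfolding lcm_upto_def using ij by (intro dvd_Lcm) (auto simp: d_def)
  then obtain t where "lcm_upto N = d * t" by blast
  then show ?thesis using iter[of t] by (simp add: add.commute)
qed

lemma s_witness_if_powers_eq: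
  assumes "subring S R" "l < m"
    and "\<And>x. x \<in> carrier R \<Longrightarrow> x [^] m = x [^] l"
  shows "s_witness S R m"
proof -
  \<comment> \<open>Normalizing matters in the zero ring, where the list for \<open>x^l\<close> has leading coefficient \<open>\<zero>\<close>.\<close>
  define p where "p = normalize (monom \<one> l)"
  have set: "set (monom \<one> l) \<subseteq> S"
    using subringE[OF assms(1)] by (auto simp: monom_def)
  have "p \<in> carrier (S [X])"
    unfolding p_def univ_poly_carrier[symmetric] by (rule normalize_gives_polynomial[OF set])
  moreover have "degree p < m"
  proof -
    have "length p \<le> Suc l"
      unfolding p_def using normalize_length_le[of "monom \<one> l"] by (simp add: monom_def)
    then show ?thesis using assms(2) by simp
  qed
  moreover have "eval p x = x [^] m" if "x \<in> carrier R" for x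
    unfolding p_def using that assms(3)
    by (simp add: eval_normalize monom_in_carrier eval_monom)
  ultimately show ?thesis
    unfolding s_witness_def using assms(2) by auto
qed

end

theorem theorem7:
  fixes R :: "('a, 'b) ring_scheme" and n \<Lambda> :: nat
  assumes "cring R"
    and "s_ring R = enat n"
    and "\<Lambda> = (fact n) ^ ((2 * n) ^ n * n)"
  shows "s_rel (generate_ring R {\<one>\<^bsub>R\<^esub>}) R \<le> enat (lcm_upto \<Lambda> + \<Lambda>)"
proof -
  interpret cring R by fact
  have "\<exists>m. s_witness (carrier R) R m" and "(LEAST m. s_witness (carrier R) R m) = n"
    using assms(2) unfolding s_ring_def s_rel_def by (auto split: if_splits)
  then have "s_witness (carrier R) R n" by (metis LeastI_ex)
  then obtain p where p_poly: "p \<in> carrier (carrier R [X]\<^bsub>R\<^esub>)" and "degree p < n"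
    and p_eval: "\<And>x. x \<in> carrier R \<Longrightarrow> eval p x = x [^]\<^bsub>R\<^esub> n"
    unfolding s_witness_def by blast
  then have len: "length p \<le> n" by simp
  have p: "set p \<subseteq> carrier R"
    using p_poly unfolding univ_poly_carrier[symmetric] by (rule polynomial_incl)
  have a: "coeff p \<in> {..<n} \<rightarrow> carrier R" using p by simp
  have rel: "x [^]\<^bsub>R\<^esub> n = (\<Oplus>\<^bsub>R\<^esub>k\<in>{..<n}. coeff p k \<otimes>\<^bsub>R\<^esub> x [^]\<^bsub>R\<^esub> k)" if "x \<in> carrier R" for x
    using eval_as_finsum_coeff[OF p len that] p_eval[OF that] by simp
  have powers: "x [^]\<^bsub>R\<^esub> (lcm_upto \<Lambda> + \<Lambda>) = x [^]\<^bsub>R\<^esub> \<Lambda>" if x: "x \<in> carrier R" for x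
  proof -
    define I where "I = ({..<n} \<rightarrow>\<^sub>E {..<2 * n}) \<times> {..<n}"
    define v where "v = (\<lambda>(\<beta>, i). multi_monom n (coeff p) \<beta> \<otimes>\<^bsub>R\<^esub> x [^]\<^bsub>R\<^esub> (i::nat))"
    have fin: "finite I" unfolding I_def by (intro finite_cartesian_product finite_PiE) auto
    have v: "v \<in> I \<rightarrow> carrier R" using a x by (auto simp: I_def v_def)
    have cardI: "card I = (2 * n) ^ n * n" by (simp add: I_def card_cartesian_product card_PiE)
    have tors: "[int (fact n)] \<cdot>\<^bsub>R\<^esub> v i = \<zero>\<^bsub>R\<^esub>" if "i \<in> I" for i
      using fact_annihilates[OF p len p_eval, of "v i"] v that by auto
    have "card (int_combinations I v) \<le> \<Lambda>"
      using card_int_combinations(2)[OF fin v _ tors] by (simp add: assms(3) cardI)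
    moreover have "finite (int_combinations I v)"
      using card_int_combinations(1)[OF fin v _ tors] by simp
    moreover have "x [^]\<^bsub>R\<^esub> j \<in> int_combinations I v" for j :: nat
    proof -
      \<comment> \<open>A bare power of \<open>x\<close> is the case of the trivial monomial in the coefficients.\<close>
      have "multi_monom n (coeff p) (\<lambda>_. 0) = \<one>\<^bsub>R\<^esub>" by (simp add: multi_monom_def)
      then show ?thesis
        using monomials_in_int_combinations[OF a rel x, of "\<lambda>_. 0" j] x
        by (simp add: I_def v_def)
    qed
    ultimately show ?thesis using x by (intro power_lcm_upto_eq)
  qed
  have "lcm_upto \<Lambda> \<noteq> 0" unfolding lcm_upto_def by (simp add: Lcm_0_iff)
  then have "s_witness (generate_ring R {\<one>\<^bsub>R\<^esub>}) R (lcm_upto \<Lambda> + \<Lambda>)"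
    using powers by (intro s_witness_if_powers_eq generate_ring_is_subring) auto
  then have "\<exists>m. s_witness (generate_ring R {\<one>\<^bsub>R\<^esub>}) R m"
    and "(LEAST m. s_witness (generate_ring R {\<one>\<^bsub>R\<^esub>}) R m) \<le> lcm_upto \<Lambda> + \<Lambda>"
    by (blast, rule Least_le)
  then show ?thesis
    unfolding s_rel_def by simp
qed

end
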